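(* Consider partial state coupling on $\mathbb{R}^n$ with fixed reference vectors $y_{ij}=y_{ji}\in S^{n-1}$, $(i,j)\in\mathcal{E}$. Then $C_o=C_s$ if and only if $\mathrm{rank}\,L^g=n(k-1)$. Moreover, if $\mathrm{rank}\,L^g=n(k-1)$, the set $C_o=C_s$ is globally exponentially stable under $$\tfrac{d}{dt}x_i=\sum_{\{j:(i,j)\in\mathcal{E}\}}M_{ij}(x_j-x_i),\qquad i=1,\ldots,k.$$
   Context: $\mathcal{G}(\mathcal{V},\mathcal{E})$ is an undirected finite graph without self-loops, $\mathcal{V}=\{1,\ldots,k\}$, $k>2$, with adjacency matrix $(a_{ij})$: $a_{ij}=1$ if $(i,j)\in\mathcal{E}$, $a_{ij}=0$ otherwise. Agent states are $x_i\in\mathbb{R}^n$, $n\ge1$. $M_{ij}=y_{ij}y_{ij}^T$. Here $C_s=\{(x_1,\ldots,x_k)\in(\mathbb{R}^n)^k: x_1=\cdots=x_k\}$ and $C_o=\{(x_1,\ldots,x_k)\in(\mathbb{R}^n)^k: x_i^Ty_{ij}=x_j^Ty_{ij}\ \forall(i,j)\in\mathcal{E}\}$. The extended Laplacian $L^g=(L^g_{ij})\in\mathbb{R}^{kn\times kn}$ has $n\times n$ blocks $L^g_{ij}=-a_{ij}M_{ij}$ for $i\ne j$ and $L^g_{ii}=\sum_{j=1}^k a_{ij}M_{ij}$. *)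

theory Defs
  imports "HOL-Analysis.Analysis"
begin

text \<open>Finite undirected graphs without self-loops are given by a symmetric, irreflexive edge
  relation on a finite vertex type \<open>'k\<close>. The state space $(\mathbb{R}^n)^k$ is \<open>real^'n^'k\<close>, whose
  norm is the Euclidean norm of $\mathbb{R}^{kn}$. The reference vectors are a function
  \<open>y :: 'k \<Rightarrow> 'k \<Rightarrow> real^'n\<close>; only its values on edges matter below.\<close>

definition adjacency :: "('k \<times> 'k) set \<Rightarrow> 'k \<Rightarrow> 'k \<Rightarrow> real" where
  "adjacency E i j = (if (i, j) \<in> E then 1 else 0)"

text \<open>The type annotations make \<open>columnvector\<close> and \<open>rowvector\<close> an $n \times 1$ and a $1 \times n$ matrix;
  in general they repeat the vector as many times as the type of the result demands.\<close>

definition coupling_matrix :: "('k \<Rightarrow> 'k \<Rightarrow> real^'n) \<Rightarrow> 'k \<Rightarrow> 'k \<Rightarrow> real^'n^'n" where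
  "coupling_matrix y i j = (columnvector (y i j) :: real^1^'n) ** (rowvector (y i j) :: real^'n^1)"

definition sync_set :: "(real^'n^'k) set" where
  "sync_set = {x. \<forall>i j. x $ i = x $ j}"

definition output_sync_set ::
    "('k \<times> 'k) set \<Rightarrow> ('k \<Rightarrow> 'k \<Rightarrow> real^'n) \<Rightarrow> (real^'n^'k) set" where
  "output_sync_set E y = {x. \<forall>(i, j)\<in>E. x $ i \<bullet> y i j = x $ j \<bullet> y i j}"

definition extended_laplacian_block ::
    "('k::finite \<times> 'k) set \<Rightarrow> ('k \<Rightarrow> 'k \<Rightarrow> real^'n) \<Rightarrow> 'k \<Rightarrow> 'k \<Rightarrow> real^'n^'n" where
  "extended_laplacian_block E y i j =
     (if i = j then (\<Sum>l\<in>UNIV. adjacency E i l *\<^sub>R coupling_matrix y i l)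
      else - (adjacency E i j *\<^sub>R coupling_matrix y i j))"

text \<open>The entry in row \<open>(i, r)\<close> and column \<open>(j, c)\<close> is the \<open>(r, c)\<close> entry of the block \<open>(i, j)\<close>.\<close>

definition extended_laplacian ::
    "('k::finite \<times> 'k) set \<Rightarrow> ('k \<Rightarrow> 'k \<Rightarrow> real^'n) \<Rightarrow> real^('k \<times> 'n)^('k \<times> 'n)" where
  "extended_laplacian E y =
     (\<chi> p q. extended_laplacian_block E y (fst p) (fst q) $ snd p $ snd q)"

definition partial_coupling_field ::
    "('k \<times> 'k) set \<Rightarrow> ('k \<Rightarrow> 'k \<Rightarrow> real^'n) \<Rightarrow> real^'n^'k \<Rightarrow> real^'n^'k" where
  "partial_coupling_field E y x =
     (\<chi> i. \<Sum>j\<in>{j. (i, j) \<in> E}. coupling_matrix y i j *v (x $ j - x $ i))"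

definition forward_solution ::
    "('a::real_normed_vector \<Rightarrow> 'a) \<Rightarrow> (real \<Rightarrow> 'a) \<Rightarrow> bool" where
  "forward_solution f x \<longleftrightarrow>
     (\<forall>t\<ge>0. (x has_vector_derivative f (x t)) (at t within {0..}))"

text \<open>Global exponential stability of a nonempty set \<open>S\<close>: solutions exist for all forward times from
  every initial state, and the distance to \<open>S\<close> decays exponentially with constants that do not
  depend on the solution. Nonemptiness is required because \<open>infdist\<close> to the empty set is 0.\<close>

definition globally_exponentially_stable ::
    "('a::real_normed_vector \<Rightarrow> 'a) \<Rightarrow> 'a set \<Rightarrow> bool" where
  "globally_exponentially_stable f S \<longleftrightarrow>
     S \<noteq> {} \<and>
     (\<forall>x0. \<exists>x. forward_solution f x \<and> x 0 = x0) \<and>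
     (\<exists>K>0. \<exists>c>0. \<forall>x. forward_solution f x \<longrightarrow>
        (\<forall>t\<ge>0. infdist (x t) S \<le> K * exp (- c * t) * infdist (x 0) S))"

end

theory Submission
  imports Defs
begin

text \<open>Up to sign and reindexing, the extended Laplacian is the matrix of the vector field \<open>f\<close>. The field
  is linear and self-adjoint, and $2\, x \cdot f(x) = -\sum_{i,j} a_{ij} (y_{ij} \cdot (x_j - x_i))^2$
  vanishes exactly on $C_o$, so $C_o$ is the kernel of \<open>f\<close>. Since $C_s \subseteq C_o$ has dimension
  \<open>n\<close>, the rank criterion is rank-nullity. For the stability, the component of a solution orthogonal
  to the kernel decays at the rate of the spectral gap of \<open>f\<close>.\<close>

section \<open>Solutions of linear differential equations\<close>

lemma linear_funpow_norm_le:
  fixes f :: "'a::real_normed_vector \<Rightarrow> 'a"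
  assumes "\<And>x. norm (f x) \<le> B * norm x" and "B \<ge> 0"
  shows "norm ((f ^^ n) x) \<le> B ^ n * norm x"
proof (induction n)
  case (Suc n)
  have "norm ((f ^^ Suc n) x) \<le> B * norm ((f ^^ n) x)"
    using assms(1) by simp
  also have "\<dots> \<le> B * (B ^ n * norm x)"
    using Suc assms(2) by (rule mult_left_mono)
  finally show ?case by (simp add: mult.assoc)
qed simp

text \<open>The solution is exp(t f) x0, written as its power series in t. A norm bound on
  \<open>f\<close> makes the series converge for every t, and pairing with a fixed vector turns it
  into a real power series, which may be differentiated term by term.\<close>

lemma linear_field_solution_exists:
  fixes f :: "'a::euclidean_space \<Rightarrow> 'a"
  assumes "linear f"
  obtains x where "forward_solution f x" and "x 0 = x0"
proof -
  have bl: "bounded_linear f"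
    using assms by (simp add: linear_conv_bounded_linear)
  obtain B where "B > 0" and B: "\<And>x. norm (f x) \<le> norm x * B"
    using bounded_linear.pos_bounded[OF bl] by blast
  define c where "c n = (f ^^ n) x0 /\<^sub>R fact n" for n
  define x where "x t = (\<Sum>n. t ^ n *\<^sub>R c n)" for t
  have norm_c: "norm (c n) \<le> B ^ n * norm x0 / fact n" for n
    using linear_funpow_norm_le[of f B n x0] B \<open>B > 0\<close>
    by (simp add: c_def mult.commute divide_simps)
  have summ: "summable (\<lambda>n. t ^ n *\<^sub>R c n)" for t
  proof (rule summable_comparison_test)
    show "summable (\<lambda>n. norm x0 * (inverse (fact n) * (\<bar>t\<bar> * B) ^ n))"
      by (intro summable_mult summable_exp)
    have "norm (t ^ n *\<^sub>R c n) \<le> norm x0 * (inverse (fact n) * (\<bar>t\<bar> * B) ^ n)" for n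
      using mult_left_mono[OF norm_c[of n], of "\<bar>t\<bar> ^ n"]
      by (simp add: power_abs field_simps power_mult_distrib)
    then show "\<exists>N. \<forall>n\<ge>N. norm (t ^ n *\<^sub>R c n) \<le> norm x0 * (inverse (fact n) * (\<bar>t\<bar> * B) ^ n)"
      by blast
  qed
  \<comment> \<open>Applying \<open>f\<close> shifts the coefficients exactly as termwise
    differentiation (\<open>diffs\<close>) does; this is what makes the series solve the
    equation.\<close>
  have f_c: "f (c n) = real (Suc n) *\<^sub>R c (Suc n)" for n
    by (simp add: c_def linear_scale[OF assms] divide_simps)
  have f_x: "f (x t) = (\<Sum>n. t ^ n *\<^sub>R f (c n))" and f_summ: "summable (\<lambda>n. t ^ n *\<^sub>R f (c n))" for t
    using bounded_linear.suminf[OF bl summ[of t]] bounded_linear.summable[OF bl summ[of t]]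
    by (simp_all add: x_def linear_scale[OF assms])
  have "((\<lambda>t. x t \<bullet> b) has_field_derivative f (x t) \<bullet> b) (at t)" for b t
  proof -
    have x_b: "x t \<bullet> b = (\<Sum>n. (c n \<bullet> b) * t ^ n)" and s_b: "summable (\<lambda>n. (c n \<bullet> b) * t ^ n)" for t
      using bounded_linear.suminf[OF bounded_linear_inner_left summ[of t], of b]
        bounded_linear.summable[OF bounded_linear_inner_left summ[of t], of b]
      by (simp_all add: x_def mult.commute)
    have "f (x t) \<bullet> b = (\<Sum>n. diffs (\<lambda>n. c n \<bullet> b) n * t ^ n)"
      unfolding f_x using bounded_linear.suminf[OF bounded_linear_inner_left f_summ[of t], of b]
      by (simp add: f_c diffs_def mult_ac del: of_nat_Suc)
    with termdiffs_strong_converges_everywhere[OF s_b, of t] show ?thesis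
      by (simp add: x_b)
  qed
  \<comment> \<open>Differentiability in a Euclidean space can be tested on the coordinates along
    basis vectors \<open>b\<close>.\<close>
  then have "(x has_vector_derivative f (x t)) (at t)" for t
    unfolding has_vector_derivative_def has_derivative_componentwise_within[of x]
    by (simp add: has_field_derivative_def mult_commute_abs mult.commute)
  then have "forward_solution f x"
    by (simp add: forward_solution_def has_vector_derivative_at_within)
  moreover have "x 0 = x0"
    \<comment> \<open>At time 0 only the term of index 0 survives, because
      \<open>0 ^ 0 = 1\<close>.\<close>
    using suminf_finite[of "{0}" "\<lambda>n. 0 ^ n *\<^sub>R c n"]
    by (simp add: x_def c_def)
  ultimately show thesis by (rule that)
qed

section \<open>Spectral gap and exponential decay for symmetric linear fields\<close>

text \<open>Compactness of the unit sphere of the orthogonal complement of \<open>S\<close> yields the spectral gap.\<close>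

lemma negative_definite_gap:
  fixes f :: "'a::euclidean_space \<Rightarrow> 'a"
  assumes "linear f" and "subspace S" and neg: "\<And>x. x \<notin> S \<Longrightarrow> x \<bullet> f x < 0"
  obtains c where "c > 0" and "\<And>w. (\<And>s. s \<in> S \<Longrightarrow> w \<bullet> s = 0) \<Longrightarrow> w \<bullet> f w \<le> - c * (norm w)\<^sup>2"
proof -
  define P where "P = {w. \<forall>s\<in>S. w \<bullet> s = 0}"
  define U where "U = sphere 0 1 \<inter> P"
  have "P = (\<Inter>s\<in>S. {w. w \<bullet> s = 0})"
    by (auto simp: P_def)
  moreover have "closed {w. w \<bullet> s = 0}" for s :: 'a
    by (intro closed_Collect_eq continuous_intros)
  ultimately have "closed P"
    by auto
  then have "compact U"
    by (simp add: U_def compact_Int_closed)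
  have "\<exists>c>0. \<forall>u\<in>U. u \<bullet> f u \<le> - c"
  proof (cases "U = {}")
    case True
    \<comment> \<open>Here \<open>S\<close> is the whole space, its complement is trivial, and any
      positive constant serves.\<close>
    then show ?thesis by (auto intro: exI[of _ 1])
  next
    case False
    have "continuous_on U (\<lambda>u. u \<bullet> f u)"
      using assms(1) by (intro continuous_intros linear_continuous_on)
        (simp add: linear_conv_bounded_linear)
    then obtain u where u: "u \<in> U" "\<And>v. v \<in> U \<Longrightarrow> v \<bullet> f v \<le> u \<bullet> f u"
      using continuous_attains_sup[OF \<open>compact U\<close> False] by blast
    \<comment> \<open>Otherwise \<open>u\<close> would be orthogonal to itself, although its norm is
      1.\<close>
    have "u \<notin> S"
      using u(1) by (auto simp: U_def P_def)
    then show ?thesis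
      using neg[of u] u(2) by (intro exI[of _ "- (u \<bullet> f u)"]) simp
  qed
  then obtain c where "c > 0" and c: "\<And>u. u \<in> U \<Longrightarrow> u \<bullet> f u \<le> - c"
    by blast
  have "w \<bullet> f w \<le> - c * (norm w)\<^sup>2" if w: "\<And>s. s \<in> S \<Longrightarrow> w \<bullet> s = 0" for w
  proof (cases "w = 0")
    case True
    then show ?thesis by simp
  next
    case False
    define u where "u = w /\<^sub>R norm w"
    have "u \<in> U"
      using w False by (simp add: U_def P_def u_def)
    have "w = norm w *\<^sub>R u"
      using False by (simp add: u_def)
    then have "w \<bullet> f w = (norm w)\<^sup>2 * (u \<bullet> f u)"
      by (metis inner_scaleR_left inner_scaleR_right linear_scale[OF assms(1)] mult.assoc power2_eq_square)
    then show ?thesis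
      using mult_left_mono[OF c[OF \<open>u \<in> U\<close>], of "(norm w)\<^sup>2"] by (simp add: mult.commute)
  qed
  with \<open>c > 0\<close> show thesis by (rule that)
qed

text \<open>The derivative of a forward solution is one-sided only at time 0. For positive times it
  is two-sided, as the mean value and monotonicity theorems on open intervals demand; the endpoint 0
  is then covered by continuity.\<close>

lemma forward_solution_has_derivative_at:
  assumes "forward_solution f x" and "t > 0"
  shows "(x has_vector_derivative f (x t)) (at t)"
proof -
  have "(x has_vector_derivative f (x t)) (at t within {0..})"
    using assms by (simp add: forward_solution_def)
  then have "(x has_vector_derivative f (x t)) (at t within {0<..})"
    by (rule has_vector_derivative_within_subset) auto
  then show ?thesis
    using at_within_open[of t "{0<..}"] assms(2) by simp
qed

lemma forward_solution_continuous_on: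
  assumes "forward_solution f x"
  shows "continuous_on {0..} x"
  using assms unfolding forward_solution_def
  by (intro continuous_on_vector_derivative) auto

text \<open>The inner products of a solution with the elements of \<open>S\<close> are conserved, so the orthogonal
  projection to \<open>S\<close> is constant and the remainder contracts at the rate of the spectral gap.\<close>

lemma symmetric_negative_globally_exponentially_stable:
  fixes f :: "'a::euclidean_space \<Rightarrow> 'a"
  assumes "linear f" and S: "subspace S"
    and sym: "\<And>x z. x \<bullet> f z = f x \<bullet> z"
    and ker: "\<And>s. s \<in> S \<Longrightarrow> f s = 0"
    and neg: "\<And>x. x \<notin> S \<Longrightarrow> x \<bullet> f x < 0"
  shows "globally_exponentially_stable f S"
proof -
  obtain c where "c > 0"
    and c: "\<And>w. (\<And>s. s \<in> S \<Longrightarrow> w \<bullet> s = 0) \<Longrightarrow> w \<bullet> f w \<le> - c * (norm w)\<^sup>2"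
    using negative_definite_gap[OF assms(1) S neg] by blast
  have "infdist (x t) S \<le> 1 * exp (- c * t) * infdist (x 0) S"
    if x: "forward_solution f x" and "t \<ge> 0" for x t
  proof -
    obtain s0 w0 where s0: "s0 \<in> span S" and w0: "\<And>s. s \<in> span S \<Longrightarrow> orthogonal w0 s"
      and x0: "x 0 = s0 + w0"
      using orthogonal_subspace_decomp_exists by metis
    have "s0 \<in> S" using s0 S by (simp add: span_eq_iff[THEN iffD2])
    \<comment> \<open>The point \<open>s0\<close> stays fixed in time. As \<open>f s0 = 0\<close>,
      the difference \<open>w\<close> solves the same equation as \<open>x\<close>.\<close>
    define w where "w t = x t - s0" for t
    have w_cont: "continuous_on {0..} w"
      unfolding w_def using forward_solution_continuous_on[OF x] by (intro continuous_intros)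
    have w_deriv: "(w has_vector_derivative f (w t)) (at t)" if "t > 0" for t
      using forward_solution_has_derivative_at[OF x that] linear_diff[OF assms(1), of "x t" s0]
        ker[OF \<open>s0 \<in> S\<close>]
      by (simp add: w_def[abs_def] has_vector_derivative_diff_const)
    have w_perp: "w t \<bullet> s = 0" if "t \<ge> 0" "s \<in> S" for t s
    proof -
      have "w t \<bullet> s = w 0 \<bullet> s"
      proof (cases "t = 0")
        case False
        show ?thesis
        proof (rule DERIV_isconst2[of 0 t "\<lambda>t. w t \<bullet> s" t])
          show "continuous_on {0..t} (\<lambda>t. w t \<bullet> s)"
            by (intro continuous_intros continuous_on_subset[OF w_cont]) auto
          show "((\<lambda>t. w t \<bullet> s) has_field_derivative 0) (at r)" if r: "0 < r" "r < t" for r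
          proof -
            \<comment> \<open>Self-adjointness moves \<open>f\<close> onto \<open>s\<close>, which
              lies in the kernel.\<close>
            have "f (w r) \<bullet> s = 0"
              using sym[of "w r" s] ker[OF \<open>s \<in> S\<close>] by simp
            then show ?thesis
              using bounded_linear.has_vector_derivative[OF bounded_linear_inner_left w_deriv[OF r(1)], of s]
              by (simp add: has_real_derivative_iff_has_vector_derivative)
          qed
        qed (use that False in auto)
      qed simp
      also have "\<dots> = 0"
        using w0[of s] span_base[OF that(2)] by (simp add: w_def x0 orthogonal_def)
      finally show ?thesis .
    qed
    \<comment> \<open>The exponential weight turns the differential inequality for the squared norm
      of \<open>w\<close> into monotonicity of \<open>V\<close>, which is the square of
      \<open>exp (c * t) * norm (w t)\<close>.\<close>
    define V where "V t = exp (2 * c * t) * (w t \<bullet> w t)" for t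
    have "V t \<le> V 0"
    proof (rule DERIV_nonpos_imp_decreasing_open[OF \<open>t \<ge> 0\<close>])
      show "continuous_on {0..t} V"
        unfolding V_def by (intro continuous_intros continuous_on_subset[OF w_cont]) auto
      fix r assume r: "0 < r" "r < t"
      have "((\<lambda>t. w t \<bullet> w t) has_field_derivative 2 * (w r \<bullet> f (w r))) (at r)"
        using has_derivative_inner[OF w_deriv[unfolded has_vector_derivative_def, OF r(1)]
            w_deriv[unfolded has_vector_derivative_def, OF r(1)]]
        by (auto simp: has_field_derivative_def inner_commute algebra_simps elim!: has_derivative_eq_rhs)
      then have "(V has_field_derivative 2 * exp (2 * c * r) * (c * (w r \<bullet> w r) + w r \<bullet> f (w r))) (at r)"
        unfolding V_def by (auto intro!: derivative_eq_intros simp: algebra_simps)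
      moreover have "c * (w r \<bullet> w r) + w r \<bullet> f (w r) \<le> 0"
        using c[of "w r"] w_perp[of r] r by (simp add: dot_square_norm)
      ultimately show "\<exists>d. (V has_field_derivative d) (at r) \<and> d \<le> 0"
        using mult_nonneg_nonpos[of "2 * exp (2 * c * r)" "c * (w r \<bullet> w r) + w r \<bullet> f (w r)"] by auto
    qed
    then have "(exp (c * t) * norm (w t))\<^sup>2 \<le> (norm (w 0))\<^sup>2"
      by (simp add: V_def dot_square_norm power_mult_distrib exp_double[symmetric] mult.assoc)
    then have "exp (c * t) * norm (w t) \<le> norm (w 0)"
      by (rule power2_le_imp_le) simp
    then have decay: "norm (w t) \<le> exp (- c * t) * norm (w 0)"
      by (simp add: exp_minus field_simps)
    have dist_le: "infdist (x t) S \<le> norm (w t)"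
      using infdist_le[OF \<open>s0 \<in> S\<close>, of "x t"] by (simp add: w_def dist_norm)
    \<comment> \<open>At later times any point of \<open>S\<close> bounds the distance from above,
      but at time 0 a lower bound is needed: by Pythagoras \<open>s0\<close> is a nearest point of
      \<open>S\<close> to \<open>x 0\<close>. Hence the stability constant \<open>K\<close> can be
      1.\<close>
    have dist_0: "norm (w 0) \<le> infdist (x 0) S"
    proof -
      have "norm (w 0) \<le> dist (x 0) s" if "s \<in> S" for s
      proof -
        have "w 0 \<bullet> (s0 - s) = 0"
          using w_perp[of 0] subspace_diff[OF S \<open>s0 \<in> S\<close> that] by simp
        then have "(norm (w 0 + (s0 - s)))\<^sup>2 = (norm (w 0))\<^sup>2 + (norm (s0 - s))\<^sup>2"
          by (intro norm_add_Pythagorean) (simp add: orthogonal_def)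
        then have "(norm (w 0))\<^sup>2 \<le> (dist (x 0) s)\<^sup>2"
          by (simp add: dist_norm w_def)
        then show ?thesis
          by (rule power2_le_imp_le) simp
      qed
      then show ?thesis
        using \<open>s0 \<in> S\<close> by (auto simp: infdist_def intro!: cINF_greatest)
    qed
    have "exp (- c * t) * norm (w 0) \<le> exp (- c * t) * infdist (x 0) S"
      by (intro mult_left_mono dist_0) simp
    with dist_le decay show ?thesis
      by linarith
  qed
  moreover have "\<exists>x. forward_solution f x \<and> x 0 = x0" for x0
    using linear_field_solution_exists[OF assms(1)] by metis
  moreover have "S \<noteq> {}"
    using subspace_0[OF S] by auto
  ultimately show ?thesis
    unfolding globally_exponentially_stable_def using \<open>c > 0\<close> zero_less_one by blast
qed

section \<open>Rank and kernel of a matrix\<close>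

text \<open>A vector is in the kernel iff it is orthogonal to every row, so the kernel is the
  orthogonal complement of the row space, whose dimension is the rank.\<close>

lemma rank_nullity:
  fixes A :: "real^'n^'m"
  shows "rank A + dim {x. A *v x = 0} = CARD('n)"
proof -
  have "A *v x = 0 \<longleftrightarrow> (\<forall>r\<in>span (rows A). orthogonal r x)" for x
  proof
    assume "A *v x = 0"
    then show "\<forall>r\<in>span (rows A). orthogonal r x"
      using orthogonal_nullspace_rowspace orthogonal_commute by blast
  next
    assume x: "\<forall>r\<in>span (rows A). orthogonal r x"
    have "row i A \<in> span (rows A)" for i
      by (intro span_base) (auto simp: rows_def)
    with x have "row i A \<bullet> x = 0" for i
      by (simp add: orthogonal_def)
    then show "A *v x = 0"
      by (simp add: vec_eq_iff matrix_vector_mul_component row_def vec_lambda_eta)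
  qed
  then have "{x. A *v x = 0} = {x \<in> UNIV. \<forall>r\<in>span (rows A). orthogonal r x}"
    by auto
  then show ?thesis
    using dim_subspace_orthogonal_to_vectors[of "span (rows A)" UNIV]
    by (simp add: row_rank_def)
qed

section \<open>The coupling field and its quadratic form\<close>

lemma coupling_matrix_mult:
  "coupling_matrix y i j *v v = (y i j \<bullet> v) *\<^sub>R y i j"
  by (simp add: coupling_matrix_def vec_eq_iff matrix_vector_mult_def matrix_matrix_mult_def
      columnvector_def rowvector_def inner_vec_def sum_distrib_left mult_ac)

text \<open>Summing over all vertices with 0-1 weights, instead of over the neighbours of
  \<open>i\<close>, gives an index set independent of \<open>i\<close>, so that double sums can be
  interchanged.\<close>

lemma partial_coupling_field_eq:
  "partial_coupling_field E y x $ i =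
     (\<Sum>j\<in>UNIV. adjacency E i j *\<^sub>R (y i j \<bullet> (x $ j - x $ i)) *\<^sub>R y i j)"
proof -
  have "partial_coupling_field E y x $ i
      = (\<Sum>j\<in>{j. (i, j) \<in> E}. (y i j \<bullet> (x $ j - x $ i)) *\<^sub>R y i j)"
    by (simp add: partial_coupling_field_def coupling_matrix_mult)
  also have "\<dots> = (\<Sum>j\<in>UNIV. adjacency E i j *\<^sub>R (y i j \<bullet> (x $ j - x $ i)) *\<^sub>R y i j)"
    by (intro sum.mono_neutral_cong_left) (auto simp: adjacency_def)
  finally show ?thesis .
qed

lemma linear_partial_coupling_field:
  "linear (partial_coupling_field E (y :: 'k::finite \<Rightarrow> 'k \<Rightarrow> real^'n))"
proof (rule linearI)
  fix x z :: "real^'n^'k" and c :: real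
  have "partial_coupling_field E y (x + z) $ i
      = partial_coupling_field E y x $ i + partial_coupling_field E y z $ i" for i
    unfolding partial_coupling_field_eq sum.distrib[symmetric]
    by (rule sum.cong) (simp_all add: inner_diff_right inner_add_right algebra_simps)
  then show "partial_coupling_field E y (x + z) = partial_coupling_field E y x + partial_coupling_field E y z"
    by (simp add: vec_eq_iff)
  have "partial_coupling_field E y (c *\<^sub>R x) $ i = c *\<^sub>R partial_coupling_field E y x $ i" for i
    unfolding partial_coupling_field_eq scaleR_sum_right
    by (rule sum.cong) (simp_all add: inner_diff_right algebra_simps)
  then show "partial_coupling_field E y (c *\<^sub>R x) = c *\<^sub>R partial_coupling_field E y x"
    by (simp add: vec_eq_iff)
qed

text \<open>Summation by parts on the graph: each edge occurs in both directions, and averaging the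
  two contributions produces the differences of \<open>x\<close>. The right-hand side is symmetric
  in \<open>x\<close> and \<open>z\<close> and nonpositive for \<open>x = z\<close>, which yields
  both self-adjointness and the sign of the field.\<close>

lemma inner_partial_coupling_field:
  fixes y :: "'k::finite \<Rightarrow> 'k \<Rightarrow> real^'n"
  assumes "sym E" and "\<And>i j. (i, j) \<in> E \<Longrightarrow> y i j = y j i"
  shows "2 * (x \<bullet> partial_coupling_field E y z) =
    - (\<Sum>i\<in>UNIV. \<Sum>j\<in>UNIV. adjacency E i j * (y i j \<bullet> (x $ j - x $ i)) * (y i j \<bullet> (z $ j - z $ i)))"
proof -
  define g where "g i j = adjacency E i j * (y i j \<bullet> (z $ j - z $ i))" for i j
  have expand: "x \<bullet> partial_coupling_field E y z = (\<Sum>i\<in>UNIV. \<Sum>j\<in>UNIV. g i j * (y i j \<bullet> x $ i))"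
    by (simp add: inner_vec_def[of x] partial_coupling_field_eq inner_sum_right g_def
        inner_commute[of "x $ _"] mult.assoc)
  \<comment> \<open>Reversing an edge keeps its weight and reference vector but flips the sign of
    the difference of \<open>z\<close>.\<close>
  have "g j i * (y j i \<bullet> x $ j) = - (g i j * (y i j \<bullet> x $ j))" for i j
  proof (cases "(i, j) \<in> E")
    case True
    then show ?thesis
      using symD[OF assms(1) True] assms(2)[OF True]
      by (simp add: g_def adjacency_def inner_diff_right algebra_simps)
  next
    case False
    then have "(j, i) \<notin> E" using assms(1) by (auto dest: symD)
    with False show ?thesis by (simp add: g_def adjacency_def)
  qed
  then have swap: "x \<bullet> partial_coupling_field E y z = - (\<Sum>i\<in>UNIV. \<Sum>j\<in>UNIV. g i j * (y i j \<bullet> x $ j))"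
    unfolding expand by (subst sum.swap) (simp add: sum_negf)
  have "2 * (x \<bullet> partial_coupling_field E y z)
      = (\<Sum>i\<in>UNIV. \<Sum>j\<in>UNIV. g i j * (y i j \<bullet> x $ i)) - (\<Sum>i\<in>UNIV. \<Sum>j\<in>UNIV. g i j * (y i j \<bullet> x $ j))"
    using expand swap by simp
  also have "\<dots> = - (\<Sum>i\<in>UNIV. \<Sum>j\<in>UNIV. g i j * (y i j \<bullet> (x $ j - x $ i)))"
    by (simp add: inner_diff_right right_diff_distrib sum_subtractf)
  finally show ?thesis
    by (simp add: g_def mult_ac)
qed

lemma partial_coupling_field_eq_0:
  assumes "x \<in> output_sync_set E y"
  shows "partial_coupling_field E y x = 0"
proof -
  have "(y i j \<bullet> (x $ j - x $ i)) = 0" if "(i, j) \<in> E" for i j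
    using assms that by (auto simp: output_sync_set_def inner_diff_right inner_commute)
  then show ?thesis
    by (simp add: partial_coupling_field_def coupling_matrix_mult vec_eq_iff)
qed

lemma partial_coupling_field_negative:
  fixes y :: "'k::finite \<Rightarrow> 'k \<Rightarrow> real^'n"
  assumes "sym E" and "\<And>i j. (i, j) \<in> E \<Longrightarrow> y i j = y j i" and "x \<notin> output_sync_set E y"
  shows "x \<bullet> partial_coupling_field E y x < 0"
proof -
  define h where "h i j = adjacency E i j * (y i j \<bullet> (x $ j - x $ i)) * (y i j \<bullet> (x $ j - x $ i))" for i j
  have h_nonneg: "h i j \<ge> 0" for i j
    by (simp add: h_def adjacency_def)
  obtain i j where "(i, j) \<in> E" and "x $ i \<bullet> y i j \<noteq> x $ j \<bullet> y i j"
    using assms(3) by (auto simp: output_sync_set_def)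
  \<comment> \<open>One edge on which the outputs disagree suffices, since no term of the double sum
    is negative.\<close>
  then have "h i j > 0"
    by (auto simp: h_def adjacency_def inner_diff_right inner_commute[of "y i j"] zero_less_mult_iff)
  also have "h i j \<le> (\<Sum>j\<in>UNIV. h i j)"
    by (intro member_le_sum) (auto simp: h_nonneg)
  also have "\<dots> \<le> (\<Sum>i\<in>UNIV. \<Sum>j\<in>UNIV. h i j)"
    by (intro member_le_sum sum_nonneg) (auto simp: h_nonneg sum_nonneg)
  finally show ?thesis
    using inner_partial_coupling_field[of E y, OF assms(1,2), of x x] by (simp add: h_def)
qed

section \<open>The extended Laplacian as the matrix of the field\<close>

text \<open>The Laplacian acts on vectors indexed by pairs, the field on vectors of vectors; this
  linear isomorphism identifies the two spaces.\<close>

definition flatten :: "real^'n^'k \<Rightarrow> real^('k::finite \<times> 'n::finite)" where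
  "flatten x = (\<chi> p. x $ fst p $ snd p)"

lemma linear_flatten: "linear flatten"
  by (rule linearI) (simp_all add: flatten_def vec_eq_iff)

lemma inj_flatten: "inj flatten"
  by (auto simp: inj_def flatten_def vec_eq_iff)

lemma surj_flatten: "surj flatten"
proof
  show "UNIV \<subseteq> range flatten"
  proof
    fix v :: "real^('k::finite \<times> 'n::finite)"
    have "v = flatten (\<chi> i r. v $ (i, r))"
      by (simp add: flatten_def vec_eq_iff)
    then show "v \<in> range flatten" by blast
  qed
qed simp

lemma extended_laplacian_flatten:
  fixes y :: "'k::finite \<Rightarrow> 'k \<Rightarrow> real^'n"
  assumes "irrefl E"
  shows "extended_laplacian E y *v flatten x = - flatten (partial_coupling_field E y x)"
proof -
  have block: "(\<Sum>j\<in>UNIV. extended_laplacian_block E y i j *v (x $ j)) = - partial_coupling_field E y x $ i" for i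
  proof -
    \<comment> \<open>Without self-loops the off-diagonal term may be subtracted for
      \<open>j = i\<close> as well, so one formula covers both kinds of block.\<close>
    have diag: "adjacency E i i = 0"
      using assms by (auto simp: adjacency_def irrefl_def)
    have "extended_laplacian_block E y i j *v v
        = (if i = j then \<Sum>l\<in>UNIV. adjacency E i l *\<^sub>R (y i l \<bullet> v) *\<^sub>R y i l else 0)
          - adjacency E i j *\<^sub>R (y i j \<bullet> v) *\<^sub>R y i j" for j v
    proof -
      have scale: "(a *\<^sub>R M) *v v = a *\<^sub>R (M *v v)" for a and M :: "real^'n^'n"
        by (simp add: vec_eq_iff matrix_vector_mult_def sum_distrib_left mult.assoc)
      have sum: "(\<Sum>l\<in>UNIV. M l) *v v = (\<Sum>l\<in>UNIV. M l *v v)" for M :: "'k \<Rightarrow> real^'n^'n"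
        by (simp add: vec_eq_iff matrix_vector_mult_def sum_distrib_right sum.swap[of _ UNIV "UNIV :: 'n set"])
      have neg: "(- M) *v v = - (M *v v)" for M :: "real^'n^'n"
        by (simp add: vec_eq_iff matrix_vector_mult_def sum_negf)
      show ?thesis
        using diag by (auto simp: extended_laplacian_block_def scale sum neg coupling_matrix_mult)
    qed
    then have "(\<Sum>j\<in>UNIV. extended_laplacian_block E y i j *v (x $ j))
        = (\<Sum>l\<in>UNIV. adjacency E i l *\<^sub>R (y i l \<bullet> x $ i) *\<^sub>R y i l)
          - (\<Sum>j\<in>UNIV. adjacency E i j *\<^sub>R (y i j \<bullet> x $ j) *\<^sub>R y i j)"
      by (simp add: sum_subtractf)
    then show ?thesis
      by (simp add: partial_coupling_field_eq inner_diff_right algebra_simps sum_subtractf)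
  qed
  show ?thesis
  proof (simp add: vec_eq_iff, intro allI)
    fix i r
    have "(extended_laplacian E y *v flatten x) $ (i, r)
        = (\<Sum>j\<in>UNIV. \<Sum>c\<in>UNIV. extended_laplacian_block E y i j $ r $ c * x $ j $ c)"
      by (simp add: matrix_vector_mult_def extended_laplacian_def flatten_def sum.cartesian_product
          case_prod_beta)
    also have "\<dots> = (\<Sum>j\<in>UNIV. extended_laplacian_block E y i j *v (x $ j)) $ r"
      by (simp add: matrix_vector_mult_def)
    finally show "(extended_laplacian E y *v flatten x) $ (i, r) = - flatten (partial_coupling_field E y x) $ (i, r)"
      by (simp add: block flatten_def)
  qed
qed

section \<open>Synchronization subspaces and the dimension count\<close>

lemma subspace_output_sync_set:
  "subspace (output_sync_set E (y :: 'k::finite \<Rightarrow> 'k \<Rightarrow> real^'n))"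
  by (fastforce simp: subspace_def output_sync_set_def inner_simps)

lemma subspace_sync_set: "subspace (sync_set :: (real^'n^'k::finite) set)"
  unfolding subspace_def sync_set_def by (simp, metis)

lemma sync_set_subset_output_sync_set: "sync_set \<subseteq> output_sync_set E y"
  unfolding sync_set_def output_sync_set_def by (auto, metis)

text \<open>The synchronization set is the image of the injective diagonal embedding of one agent's
  state space.\<close>

lemma dim_sync_set: "dim (sync_set :: (real^'n^'k::finite) set) = CARD('n)"
proof -
  let ?d = "\<lambda>v. (\<chi> i. v) :: real^'n^'k"
  have "sync_set = range ?d"
  proof
    show "sync_set \<subseteq> range ?d"
    proof
      fix x :: "real^'n^'k"
      assume "x \<in> sync_set"
      then have "x = ?d (x $ undefined)"
        by (simp add: sync_set_def vec_eq_iff[of x])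
      then show "x \<in> range ?d" by blast
    qed
  qed (auto simp: sync_set_def)
  moreover have "linear ?d"
    by (rule linearI) (simp_all add: vec_eq_iff)
  moreover have "inj ?d"
    by (auto simp: inj_def vec_eq_iff)
  ultimately show ?thesis
    using dim_image_eq[of ?d UNIV] by simp
qed

lemma rank_extended_laplacian:
  fixes y :: "'k::finite \<Rightarrow> 'k \<Rightarrow> real^'n"
  assumes "sym E" and "irrefl E" and "\<And>i j. (i, j) \<in> E \<Longrightarrow> y i j = y j i"
  shows "rank (extended_laplacian E y) + dim (output_sync_set E y) = CARD('k) * CARD('n)"
proof -
  \<comment> \<open>Outside the output synchronization set \<open>x \<bullet> f x\<close> is
    strictly negative for the field \<open>f\<close>, so \<open>f x\<close> cannot vanish
    there.\<close>
  have ker: "partial_coupling_field E y x = 0 \<longleftrightarrow> x \<in> output_sync_set E y" for x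
    using partial_coupling_field_eq_0 partial_coupling_field_negative[OF assms(1), of y x] assms(3)
    by (metis inner_zero_right less_irrefl)
  have "extended_laplacian E y *v flatten x = 0 \<longleftrightarrow> x \<in> output_sync_set E y" for x
    using linear_injective_0[OF linear_flatten] inj_flatten linear_0[OF linear_flatten]
    by (auto simp: extended_laplacian_flatten[OF assms(2)] simp flip: ker)
  then have "{v. extended_laplacian E y *v v = 0} = flatten ` output_sync_set E y"
    by (auto simp: image_iff) (metis surj_flatten surjD)
  then have "dim {v. extended_laplacian E y *v v = 0} = dim (output_sync_set E y)"
    using dim_image_eq[OF linear_flatten] inj_on_subset[OF inj_flatten subset_UNIV] by metis
  then show ?thesis
    using rank_nullity[of "extended_laplacian E y"] by simp
qed

theorem proposition3:
  fixes E :: "('k::finite \<times> 'k) set"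
    and y :: "'k \<Rightarrow> 'k \<Rightarrow> real^'n"
  assumes "CARD('k) > 2"
    and "sym E" and "irrefl E"
    and "\<And>i j. (i, j) \<in> E \<Longrightarrow> y i j \<in> sphere 0 1"
    and "\<And>i j. (i, j) \<in> E \<Longrightarrow> y i j = y j i"
  shows "(output_sync_set E y = sync_set \<longleftrightarrow>
           rank (extended_laplacian E y) = CARD('n) * (CARD('k) - 1)) \<and>
         (rank (extended_laplacian E y) = CARD('n) * (CARD('k) - 1) \<longrightarrow>
           output_sync_set E y = sync_set \<and>
           globally_exponentially_stable (partial_coupling_field E y) (output_sync_set E y))"
proof -
  \<comment> \<open>The subtraction is on natural numbers; the bound on \<open>CARD('k)\<close>
    keeps it from truncating.\<close>
  have "CARD('k) * CARD('n) = CARD('n) * (CARD('k) - 1) + CARD('n)"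
    using assms(1) by (simp add: algebra_simps)
  then have "rank (extended_laplacian E y) = CARD('n) * (CARD('k) - 1)
      \<longleftrightarrow> dim (output_sync_set E y) = dim (sync_set :: (real^'n^'k) set)"
    using rank_extended_laplacian[of E y, OF assms(2,3,5)] unfolding dim_sync_set by linarith
  also have "\<dots> \<longleftrightarrow> output_sync_set E y = sync_set"
    \<comment> \<open>Nested subspaces of equal finite dimension coincide.\<close>
    using subspace_dim_equal[OF subspace_sync_set subspace_output_sync_set
        sync_set_subset_output_sync_set[of E y]] by auto
  finally have rank: "output_sync_set E y = sync_set \<longleftrightarrow>
      rank (extended_laplacian E y) = CARD('n) * (CARD('k) - 1)"
    by simp
  have "x \<bullet> partial_coupling_field E y z = partial_coupling_field E y x \<bullet> z" for x z
    using inner_partial_coupling_field[of E y, OF assms(2,5), of x z]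
      inner_partial_coupling_field[of E y, OF assms(2,5), of z x]
    by (simp add: mult_ac inner_commute)
  then have "globally_exponentially_stable (partial_coupling_field E y) (output_sync_set E y)"
    using linear_partial_coupling_field subspace_output_sync_set partial_coupling_field_eq_0
      partial_coupling_field_negative[of E y, OF assms(2,5)]
    by (intro symmetric_negative_globally_exponentially_stable) auto
  with rank show ?thesis by blast
qed

end
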